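(* The AJ conjecture holds for the knot $7_4$, in the following form: with $P_{7_4}(q,M,L)=\sum_{j=0}^5a_j(q,M)L^j$ the explicit operator given in the context (the operator of the inhomogeneous non-commutative $A$-polynomial of $7_4$) and $A_{-7_4}^{\mathrm{red}}$ the reduced $A$-polynomial of the mirror image $-7_4$ of $7_4$, $$P_{7_4}(1,M,L)=A_{-7_4}^{\mathrm{red}}(M^{1/2},L)\,(M-1)^5(M+1)^4(2M^4-5M^3+8M^2-5M+2).$$
   Context: **Background.** Let $\mathbb W=\mathbb Q(q,M)\langle L\rangle/(LM-qML)$ act on sequences $f_n(q)$ by $(Lf)_n=f_{n+1}$, $(Mf)_n=q^nf_n$. The non-commutative $A$-polynomial of a knot $K$ is the minimal-order element of $\mathbb W$ annihilating its colored Jones sequence $J_{K,n}(q)$ (normalized to be $1$ at the unknot, $n$ the dimension of the coloring representation of $\mathfrak{sl}_2(\mathbb C)$). For $K=7_4$ it is, up to left multiplication by an element of $\mathbb Q(q,M)$, equal to $(L-1)\,b^{-1}P_{7_4}$, where $P_{7_4}J_{7_4,n}(q)=b$ with $0\neq b\in\mathbb Q(q,q^n)$ and $P_{7_4}$ is as below. The AJ conjecture relates the specialization at $q=1$ of the non-commutative $A$-polynomial of $K$ to the classical $A$-polynomial of $K$, which parametrizes the $\mathrm{SL}(2,\mathbb C)$ representations of the knot complement viewed from the boundary torus. **Reduced $A$-polynomial.** The $A$-polynomial of $7_4$ (non-abelian part) is $$A_{7_4}(M,L)=(L^2M^8-LM^8+LM^6+2LM^4+LM^2-L+1)^2\,G(M,L),$$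 $G=L^3M^{14}-2L^2M^{14}+LM^{14}+6L^2M^{12}-2LM^{12}+2L^2M^{10}+3LM^{10}-7L^2M^8+2LM^8+2L^2M^6-7LM^6+3L^2M^4+2LM^4-2L^2M^2+6LM^2+L^2-2L+1$. The reduced $A$-polynomial $A^{\mathrm{red}}_{7_4}$ is its squarefree part, $A^{\mathrm{red}}_{7_4}=(L^2M^8-LM^8+LM^6+2LM^4+LM^2-L+1)\,G$, and $A^{\mathrm{red}}_{-7_4}(M,L)=A^{\mathrm{red}}_{7_4}(M,L^{-1})L^5\in\mathbb Z[M,L]$. (Only even powers of $M$ occur.) **The operator $P_{7_4}=\sum_{j=0}^5a_jL^j$.** At $q=1$ it is viewed as a commutative polynomial in $M,L$. $a_5=(qM-1)(qM+1)(qM^2-1)(q^2M-1)(q^2M+1)(q^3M^2-1)(q^5M-1)\big(q^8(q+1)M^4-q^5(q^3+2q^2+q+1)M^3+q^2(2q^4+q^3+2q^2+2q+1)M^2-q(q^3+2q^2+q+1)M+(q+1)\big)$. $a_4=q(qM-1)(qM+1)(qM^2-1)(q^3M^2-1)(q^4M-1)^2(q^4M+1)\big(q^{33}(q+1)M^{11}-q^{29}(q+2)(q^3+q+1)M^{10}+q^{24}(q+1)(2q^6-2q^5+5q^4+q^3+4q^2+3q-1)M^9-q^{20}(4q^7+2q^6+9q^5+10q^4+6q^3+6q^2-q-2)M^8-q^{16}(2q^{11}+q^9-2q^8-4q^7-12q^5-10q^4-3q^3+6q+3)M^7+q^{12}(q^{13}+2q^{12}+5q^{11}+q^{10}+4q^9-2q^7-8q^5+q^4+7q^3+7q^2+7q+2)M^6-q^9(q^{13}+3q^{12}+8q^{11}+8q^{10}+q^9+4q^8+q^7+3q^6+q^5-4q^4+7q^3+10q^2+7q+3)M^5+q^6(4q^{12}+7q^{11}+9q^{10}+4q^9-2q^8+q^7-4q^6-3q^5-3q^4-q^3+5q^2+4q+2)M^4-q^5(q^{10}+5q^9+6q^8+3q^7-7q^6-10q^5-7q^4-9q^3-9q^2-9q-3)M^3+q^2(q^2+q+1)(q^7+2q^6-5q^5-5q^4-3q^3-2q^2-3q-2)M^2+q(q^5+6q^4+9q^3+8q^2+3q+2)M-(q+1)(q+2)\big)$.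 $a_3=-q^2(qM-1)(qM+1)(qM^2-1)(q^3M-1)^2(q^3M+1)(q^9M^2-1)\big(q^{41}(q+1)M^{15}-q^{37}(q^4+2q^3+3q^2+4q+1)M^{14}+q^{34}(q^5+q^4+7q^3+9q^2+8q+3)M^{13}+q^{29}(q^9+2q^8-2q^7-2q^6-10q^5-17q^4-12q^3-3q^2+2q+1)M^{12}-q^{25}(2q^{11}+4q^{10}+5q^9+4q^8-3q^7-11q^6-17q^5-11q^4+2q^3+8q^2+5q+1)M^{11}+q^{22}(6q^{11}+12q^{10}+8q^9+8q^8-14q^6-19q^5-6q^4+11q^3+16q^2+9q+2)M^{10}+q^{18}(2q^{14}-2q^{13}-9q^{12}-17q^{11}-11q^{10}+10q^8+20q^7+24q^6+7q^5-15q^4-20q^3-10q^2+1)M^9-q^{15}(q^{15}+6q^{14}-3q^{13}-14q^{12}-14q^{11}-4q^{10}+11q^9+25q^8+36q^7+35q^6+16q^5-9q^4-13q^3-6q^2+3q+3)M^8+q^{12}(4q^{15}+6q^{14}-3q^{13}-18q^{12}-16q^{11}+4q^{10}+23q^9+30q^8+39q^7+31q^6+12q^5-14q^4-14q^3-q^2+3q+3)M^7-q^9(5q^{15}+3q^{14}-11q^{13}-23q^{12}-18q^{11}+2q^{10}+19q^9+20q^8+21q^7+8q^6-7q^5-20q^4-22q^3-5q^2+q+1)M^6+q^8(q+1)(2q^{12}-4q^{11}-13q^{10}-17q^9-q^8+2q^7+11q^6-2q^5+5q^4-9q^3-13q^2-12q-6)M^5+q^5(5q^{12}+16q^{11}+25q^{10}+11q^9-8q^8-19q^7-16q^6-4q^5-2q^4+6q^3+11q^2+5q+1)M^4-q^4(2q^{10}+10q^9+9q^8-3q^7-22q^6-23q^5-20q^4-13q^3-6q^2-3q+1)M^3+q^2(q+1)(2q^7-4q^6-6q^5-17q^4-6q^3-6q^2-2q-1)M^2+q(2q^5+8q^4+11q^3+10q^2+3q+1)M-(q+1)(2q+1)\big)$.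 The remaining coefficients are $a_j(q,M)=-q^{60}M^{24}a_{5-j}\big(q,(q^5M)^{-1}\big)$ for $j=0,1,2$. *)

theory Defs
  imports
    "HOL-Computational_Algebra.Polynomial_Factorial"
    "HOL-Computational_Algebra.Squarefree"
begin

text \<open>
  Three kinds of objects occur below.

  \<^item> The field of rational functions in \<open>q\<close> and \<open>M\<close> is the fraction field of
    \<open>int poly poly\<close>, where the inner variable is \<open>q\<close> and the outer one is \<open>M\<close>.
  \<^item> The operator \<open>P_7_4\<close> of the knot \<open>7_4\<close> is an element of the ring generated over this
    field by \<open>L\<close> subject to \<open>L M = q M L\<close>. Every element of that ring is uniquely of the
    form \<open>\<Sum>j. a j * L ^ j\<close> with the coefficients on the left; the type \<open>rat_fun_qM poly\<close>
    holds these coefficients. The product of \<open>rat_fun_qM poly\<close>, in which \<open>L\<close>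
    commutes with \<open>M\<close>, is not the product of operators; it plays no role before \<open>q = 1\<close>.
  \<^item> \<open>A\<close>-polynomials have type \<open>int poly poly\<close>, where now the inner variable is \<open>M\<close>
    and the outer one is \<open>L\<close>.
\<close>

type_synonym rat_fun_qM = "int poly poly fract"

definition q_var :: rat_fun_qM where
  "q_var = to_fract [:[:0, 1:]:]"

definition M_var :: rat_fun_qM where
  "M_var = to_fract [:0, 1:]"

text \<open>
  The leading coefficients are functions of \<open>M\<close>, with \<open>q\<close> fixed, because the trailing ones
  are obtained from them by the substitution of \<open>1 / (q ^ 5 * M)\<close> for \<open>M\<close>.
\<close>

definition a5 :: "rat_fun_qM \<Rightarrow> rat_fun_qM" where
  "a5 M = (let q = q_var in
     (q * M - 1) * (q * M + 1) * (q * M^2 - 1) * (q^2 * M - 1) * (q^2 * M + 1) * (q^3 * M^2 -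
     1) * (q^5 * M - 1) *
      (q^8 * (q + 1) * M^4
       - q^5 * (q^3 + 2 * q^2 + q + 1) * M^3
       + q^2 * (2 * q^4 + q^3 + 2 * q^2 + 2 * q + 1) * M^2
       - q * (q^3 + 2 * q^2 + q + 1) * M
       + (q + 1)))"

definition a4 :: "rat_fun_qM \<Rightarrow> rat_fun_qM" where
  "a4 M = (let q = q_var in
     q * (q * M - 1) * (q * M + 1) * (q * M^2 - 1) * (q^3 * M^2 - 1) * (q^4 * M - 1)^2 *
     (q^4 * M + 1) *
      (q^33 * (q + 1) * M^11
       - q^29 * (q + 2) * (q^3 + q + 1) * M^10
       + q^24 * (q + 1) * (2 * q^6 - 2 * q^5 + 5 * q^4 + q^3 + 4 * q^2 + 3 * q - 1) * M^9
       - q^20 * (4 * q^7 + 2 * q^6 + 9 * q^5 + 10 * q^4 + 6 * q^3 + 6 * q^2 - q - 2) * M^8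
       - q^16 * (2 * q^11 + q^9 - 2 * q^8 - 4 * q^7 - 12 * q^5 - 10 * q^4 - 3 * q^3 + 6 * q +
           3) * M^7
       + q^12 * (q^13 + 2 * q^12 + 5 * q^11 + q^10 + 4 * q^9 - 2 * q^7 - 8 * q^5 + q^4 + 7 * q^3
           + 7 * q^2 + 7 * q + 2) * M^6
       - q^9 * (q^13 + 3 * q^12 + 8 * q^11 + 8 * q^10 + q^9 + 4 * q^8 + q^7 + 3 * q^6 + q^5 -
           4 * q^4 + 7 * q^3 + 10 * q^2 + 7 * q + 3) * M^5
       + q^6 * (4 * q^12 + 7 * q^11 + 9 * q^10 + 4 * q^9 - 2 * q^8 + q^7 - 4 * q^6 - 3 * q^5 -
           3 * q^4 - q^3 + 5 * q^2 + 4 * q + 2) * M^4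
       - q^5 * (q^10 + 5 * q^9 + 6 * q^8 + 3 * q^7 - 7 * q^6 - 10 * q^5 - 7 * q^4 - 9 * q^3 -
           9 * q^2 - 9 * q - 3) * M^3
       + q^2 * (q^2 + q + 1) * (q^7 + 2 * q^6 - 5 * q^5 - 5 * q^4 - 3 * q^3 - 2 * q^2 - 3 * q -
           2) * M^2
       + q * (q^5 + 6 * q^4 + 9 * q^3 + 8 * q^2 + 3 * q + 2) * M
       - (q + 1) * (q + 2)))"

definition a3 :: "rat_fun_qM \<Rightarrow> rat_fun_qM" where
  "a3 M = (let q = q_var in
     - (q^2) * (q * M - 1) * (q * M + 1) * (q * M^2 - 1) * (q^3 * M - 1)^2 * (q^3 * M + 1) *
     (q^9 * M^2 - 1) *
      (q^41 * (q + 1) * M^15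
       - q^37 * (q^4 + 2 * q^3 + 3 * q^2 + 4 * q + 1) * M^14
       + q^34 * (q^5 + q^4 + 7 * q^3 + 9 * q^2 + 8 * q + 3) * M^13
       + q^29 * (q^9 + 2 * q^8 - 2 * q^7 - 2 * q^6 - 10 * q^5 - 17 * q^4 - 12 * q^3 - 3 * q^2 +
           2 * q + 1) * M^12
       - q^25 * (2 * q^11 + 4 * q^10 + 5 * q^9 + 4 * q^8 - 3 * q^7 - 11 * q^6 - 17 * q^5 -
           11 * q^4 + 2 * q^3 + 8 * q^2 + 5 * q + 1) * M^11
       + q^22 * (6 * q^11 + 12 * q^10 + 8 * q^9 + 8 * q^8 - 14 * q^6 - 19 * q^5 - 6 * q^4 +
           11 * q^3 + 16 * q^2 + 9 * q + 2) * M^10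
       + q^18 * (2 * q^14 - 2 * q^13 - 9 * q^12 - 17 * q^11 - 11 * q^10 + 10 * q^8 + 20 * q^7 +
           24 * q^6 + 7 * q^5 - 15 * q^4 - 20 * q^3 - 10 * q^2 + 1) * M^9
       - q^15 * (q^15 + 6 * q^14 - 3 * q^13 - 14 * q^12 - 14 * q^11 - 4 * q^10 + 11 * q^9 +
           25 * q^8 + 36 * q^7 + 35 * q^6 + 16 * q^5 - 9 * q^4 - 13 * q^3 - 6 * q^2 + 3 * q +
           3) * M^8
       + q^12 * (4 * q^15 + 6 * q^14 - 3 * q^13 - 18 * q^12 - 16 * q^11 + 4 * q^10 + 23 * q^9 +
           30 * q^8 + 39 * q^7 + 31 * q^6 + 12 * q^5 - 14 * q^4 - 14 * q^3 - q^2 + 3 * q +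
           3) * M^7
       - q^9 * (5 * q^15 + 3 * q^14 - 11 * q^13 - 23 * q^12 - 18 * q^11 + 2 * q^10 + 19 * q^9 +
           20 * q^8 + 21 * q^7 + 8 * q^6 - 7 * q^5 - 20 * q^4 - 22 * q^3 - 5 * q^2 + q +
           1) * M^6
       + q^8 * (q + 1) * (2 * q^12 - 4 * q^11 - 13 * q^10 - 17 * q^9 - q^8 + 2 * q^7 + 11 * q^6
           - 2 * q^5 + 5 * q^4 - 9 * q^3 - 13 * q^2 - 12 * q - 6) * M^5
       + q^5 * (5 * q^12 + 16 * q^11 + 25 * q^10 + 11 * q^9 - 8 * q^8 - 19 * q^7 - 16 * q^6 -
           4 * q^5 - 2 * q^4 + 6 * q^3 + 11 * q^2 + 5 * q + 1) * M^4
       - q^4 * (2 * q^10 + 10 * q^9 + 9 * q^8 - 3 * q^7 - 22 * q^6 - 23 * q^5 - 20 * q^4 -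
           13 * q^3 - 6 * q^2 - 3 * q + 1) * M^3
       + q^2 * (q + 1) * (2 * q^7 - 4 * q^6 - 6 * q^5 - 17 * q^4 - 6 * q^3 - 6 * q^2 - 2 * q -
           1) * M^2
       + q * (2 * q^5 + 8 * q^4 + 11 * q^3 + 10 * q^2 + 3 * q + 1) * M
       - (q + 1) * (2 * q + 1)))"

definition a_top :: "nat \<Rightarrow> rat_fun_qM \<Rightarrow> rat_fun_qM" where
  "a_top j = (if j = 5 then a5 else if j = 4 then a4 else a3)"

definition a_coeff :: "nat \<Rightarrow> rat_fun_qM" where
  "a_coeff j =
    (if j \<in> {3, 4, 5} then a_top j M_var
     else - (q_var ^ 60) * M_var ^ 24 * a_top (5 - j) (inverse (q_var ^ 5 * M_var)))"

definition P_7_4 :: "rat_fun_qM poly" where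
  "P_7_4 = (\<Sum>j\<le>5. monom (a_coeff j) j)"


text \<open>
  Specialization at \<open>q = 1\<close>. A rational function can be specialized if it has
  a representation as a fraction whose denominator does not vanish identically at \<open>q = 1\<close>; by
  the lemma \<open>at_q1_Fract\<close> the value does not depend on this representation. Without such
  a representation \<open>at_q1\<close> is unspecified. Operators are specialized coefficientwise, by
  \<open>map_poly at_q1\<close>, which gives commutative polynomials in \<open>L\<close> over \<open>\<rat>(M)\<close>.
\<close>

definition num_at_q1 :: "int poly poly \<Rightarrow> int poly" where
  "num_at_q1 = map_poly (\<lambda>c. poly c 1)"

definition at_q1 :: "rat_fun_qM \<Rightarrow> int poly fract" where
  "at_q1 x = (THE y. \<exists>a b. x = Fract a b \<and> num_at_q1 b \<noteq> 0 \<and>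
                            y = Fract (num_at_q1 a) (num_at_q1 b))"

lemma num_at_q1_mult: "num_at_q1 (a * b) = num_at_q1 a * num_at_q1 b"
  by (rule poly_eqI) (simp add: num_at_q1_def coeff_map_poly coeff_mult poly_sum)

lemma at_q1_Fract:
  assumes "num_at_q1 b \<noteq> 0"
  shows "at_q1 (Fract a b) = Fract (num_at_q1 a) (num_at_q1 b)"
  unfolding at_q1_def
proof (rule the_equality)
  fix y
  assume "\<exists>c d. Fract a b = Fract c d \<and> num_at_q1 d \<noteq> 0 \<and>
            y = Fract (num_at_q1 c) (num_at_q1 d)"
  then obtain c d where cd: "Fract a b = Fract c d" "num_at_q1 d \<noteq> 0"
    and y: "y = Fract (num_at_q1 c) (num_at_q1 d)"
    by blast
  have "b \<noteq> 0" "d \<noteq> 0"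
    using assms cd(2) by (auto simp: num_at_q1_def)
  then have "a * d = c * b"
    using cd(1) by (simp add: eq_fract)
  then have "num_at_q1 a * num_at_q1 d = num_at_q1 c * num_at_q1 b"
    by (metis num_at_q1_mult)
  then show "y = Fract (num_at_q1 a) (num_at_q1 b)"
    using assms cd(2) by (simp add: y eq_fract)
qed (use assms in blast)

lemma at_q1_0: "at_q1 0 = 0"
  using at_q1_Fract[of 1 0] by (simp add: num_at_q1_def Zero_fract_def)


text \<open>The non-abelian part of the \<open>A\<close>-polynomial of \<open>7_4\<close>, and its squarefree part.\<close>

definition F_7_4 :: "int poly poly" where
  "F_7_4 = (let M = [:[:0, 1:]:]; L = [:0, 1:] in
     L^2 * M^8 - L * M^8 + L * M^6 + 2 * L * M^4 + L * M^2 - L + 1)"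

definition G_7_4 :: "int poly poly" where
  "G_7_4 = (let M = [:[:0, 1:]:]; L = [:0, 1:] in
     L^3 * M^14 - 2 * L^2 * M^14 + L * M^14 + 6 * L^2 * M^12 - 2 * L * M^12 + 2 * L^2 * M^10 +
     3 * L * M^10 - 7 * L^2 * M^8 + 2 * L * M^8 + 2 * L^2 * M^6 - 7 * L * M^6 + 3 * L^2 * M^4 +
     2 * L * M^4 - 2 * L^2 * M^2 + 6 * L * M^2 + L^2 - 2 * L + 1)"

definition A_7_4 :: "int poly poly" where
  "A_7_4 = F_7_4 ^ 2 * G_7_4"

definition A_red_7_4 :: "int poly poly" where
  "A_red_7_4 = F_7_4 * G_7_4"

text \<open>
  The reduced \<open>A\<close>-polynomial of the mirror image is \<open>A_red_7_4(M, 1 / L) * L ^ 5\<close>; as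
  \<open>A_red_7_4\<close> has degree \<open>5\<close> in \<open>L\<close>, this is the polynomial with the reversed sequence of
  coefficients.
\<close>

definition A_red_minus_7_4 :: "int poly poly" where
  "A_red_minus_7_4 = (\<Sum>j\<le>5. monom (coeff A_red_7_4 j) (5 - j))"

lemma F_7_4_eq:
  "F_7_4 = [:1, [:-1, 0, 1, 0, 2, 0, 1, 0, -1:], [:0, 0, 0, 0, 0, 0, 0, 0, 1:]:]"
  by (simp add: F_7_4_def Let_def eval_nat_numeral numeral_poly one_pCons)

lemma G_7_4_eq:
  "G_7_4 = [:1, [:-2, 0, 6, 0, 2, 0, -7, 0, 2, 0, 3, 0, -2, 0, 1:],
     [:1, 0, -2, 0, 3, 0, 2, 0, -7, 0, 2, 0, 6, 0, -2:],
     [:0, 0, 0, 0, 0, 0, 0, 0, 0, 0, 0, 0, 0, 0, 1:]:]"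
  by (simp add: G_7_4_def Let_def eval_nat_numeral numeral_poly one_pCons)

lemma degree_A_red_7_4: "degree A_red_7_4 = 5"
proof -
  have "F_7_4 \<noteq> 0 \<and> degree F_7_4 = 2" "G_7_4 \<noteq> 0 \<and> degree G_7_4 = 3"
    by (simp_all add: F_7_4_eq G_7_4_eq)
  then show ?thesis
    by (simp add: A_red_7_4_def degree_mult_eq)
qed

lemma poly_A_red_minus_7_4:
  assumes "l \<noteq> 0"
  shows "poly (map_poly to_fract A_red_minus_7_4) l =
           poly (map_poly to_fract A_red_7_4) (inverse l) * l ^ 5"
proof -
  have "map_poly to_fract A_red_minus_7_4 =
          (\<Sum>j\<le>5. monom (to_fract (coeff A_red_7_4 j)) (5 - j))"
    by (rule poly_eqI) (simp add: A_red_minus_7_4_def coeff_map_poly coeff_sum if_distrib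
      cong: if_cong)
  moreover have "poly (map_poly to_fract A_red_7_4) (inverse l) =
          (\<Sum>j\<le>5. to_fract (coeff A_red_7_4 j) * inverse l ^ j)"
    by (simp add: poly_altdef degree_map_poly degree_A_red_7_4 coeff_map_poly)
  ultimately show ?thesis
    using assms by (auto simp: poly_sum poly_monom sum_distrib_left power_diff divide_inverse
      power_inverse mult_ac intro!: sum.cong)
qed

text \<open>
  For a polynomial \<open>A\<close> in \<open>M\<close> and \<open>L\<close> which is even in \<open>M\<close>, \<open>at_sqrt_M A\<close> is
  \<open>A(M^(1/2), L)\<close>, that is, the unique polynomial \<open>B\<close> with \<open>B(M ^ 2, L) = A(M, L)\<close>.
\<close>

definition subst_M_squared :: "int poly poly \<Rightarrow> int poly poly" where
  "subst_M_squared = map_poly (\<lambda>p. pcompose p (monom 1 2))"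

definition at_sqrt_M :: "int poly poly \<Rightarrow> int poly poly" where
  "at_sqrt_M A = (THE B. subst_M_squared B = A)"

lemma inj_subst_M_squared: "inj subst_M_squared"
proof (rule injI)
  fix B C :: "int poly poly"
  assume eq: "subst_M_squared B = subst_M_squared C"
  show "B = C"
  proof (rule poly_eqI)
    fix n
    have "coeff (subst_M_squared B) n = coeff (subst_M_squared C) n"
      by (simp add: eq)
    then have "pcompose (coeff B n - coeff C n) (monom 1 2) = 0"
      by (simp add: subst_M_squared_def coeff_map_poly pcompose_diff)
    then have "coeff B n - coeff C n = 0"
      by (rule pcompose_eq_0) (simp add: degree_monom_eq)
    then show "coeff B n = coeff C n"
      by simp
  qed
qed

lemma at_sqrt_M_subst: "at_sqrt_M (subst_M_squared B) = B"
  unfolding at_sqrt_M_def by (rule the_equality) (auto dest: injD[OF inj_subst_M_squared])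

lemma subst_M_squared_A_red_minus_7_4:
  "A_red_minus_7_4 = subst_M_squared
     [:[:0, 0, 0, 0, 0, 0, 0, 0, 0, 0, 0, 1:],
       [:0, 0, 0, 0, 1, -2, 3, 1, -6, 4, 7, -3:],
       [:-1, 3, -3, -2, 10, 6, -17, -3, 21, 3, -10, 3:],
       [:3, -10, 3, 21, -3, -17, 6, 10, -2, -3, 3, -1:],
       [:-3, 7, 4, -6, 1, 3, -2, 1:],
       [:1:]:]"
proof -
  have expand: "(\<Sum>j\<le>5. f j) = f 0 + f 1 + f 2 + f 3 + f 4 + f 5" for f :: "nat \<Rightarrow> int poly poly"
    by (simp add: eval_nat_numeral add.assoc)
  show ?thesis
    unfolding A_red_minus_7_4_def A_red_7_4_def F_7_4_eq G_7_4_eq subst_M_squared_def expand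
    by (simp add: eval_nat_numeral monom_Suc monom_0 map_poly_pCons pcompose_pCons one_pCons)
qed

text \<open>
  The explicit product \<open>A_red_7_4\<close> is the squarefree part of \<open>A_7_4\<close>: it is squarefree and has
  the same irreducible factors. For the squarefreeness, a repeated factor of positive degree in
  \<open>L\<close> would remain one at \<open>M = 2\<close>, where a Bezout identity for the polynomial and its
  derivative excludes it; a factor of degree \<open>0\<close> divides the constant coefficient, which is
  \<open>1\<close>.
\<close>

lemma A_red_7_4_at_M_2:
  "map_poly (\<lambda>c. poly c 2) A_red_7_4 = [:1, 11225, -1794485, 4149595, -4560640, 4194304:]"
proof -
  have "map_poly (\<lambda>c. poly c 2) (A * B) = map_poly (\<lambda>c. poly c 2) A * map_poly (\<lambda>c. poly c 2) B"
    for A B :: "int poly poly"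
    by (rule poly_eqI) (simp add: coeff_map_poly coeff_mult poly_sum)
  moreover have "map_poly (\<lambda>c. poly c 2) F_7_4 = [:1, -157, 256:]"
    and "map_poly (\<lambda>c. poly c 2) G_7_4 = [:1, 11382, -7767, 16384:]"
    by (simp_all add: F_7_4_eq G_7_4_eq map_poly_pCons)
  ultimately show ?thesis
    by (simp add: A_red_7_4_def)
qed

lemma squarefree_A_red_7_4: "squarefree A_red_7_4"
proof (rule squarefreeI)
  fix x :: "int poly poly"
  assume "x ^ 2 dvd A_red_7_4"
  then obtain y where y: "A_red_7_4 = x * (x * y)"
    by (auto simp: power2_eq_square mult.assoc)
  define ev :: "int poly poly \<Rightarrow> int poly" where "ev = map_poly (\<lambda>c. poly c 2)"
  have ev_mult: "ev (A * B) = ev A * ev B" for A B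
    by (rule poly_eqI) (simp add: ev_def coeff_map_poly coeff_mult poly_sum)
  define f :: "int poly" where
    "f = [:1, 11225, -1794485, 4149595, -4560640, 4194304:]"
  have f: "f = ev x * (ev x * ev y)"
    using A_red_7_4_at_M_2 by (simp add: f_def ev_def [symmetric] y ev_mult)
  have "ev x dvd pderiv f"
    by (simp add: f pderiv_mult)
  moreover have "ev x dvd f"
    by (simp add: f)
  ultimately have "ev x dvd
      [:1527646464881106655784075, -5333393635177467871849815, 7823231276306741698298880,
        -9027285318351076867440640:] * f +
      [:2378526397367655977213, -766684925638721467328842, 1779886463118641203654173,
        -1957275864505548618940672, 1805457063670215373488128:] * pderiv f"
    by (intro dvd_add dvd_mult)
  also have "\<dots> = [:28226605275333045000000000:]"
    by (simp add: f_def pderiv_pCons)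
  finally have ev_x: "ev x dvd [:28226605275333045000000000:]" .
  have "degree (ev x) = 0"
    using dvd_imp_degree_le[OF ev_x] by simp
  have "degree f = 5"
    by (simp add: f_def)
  have "f \<noteq> 0"
    by (simp add: f_def)
  then have nz: "ev x \<noteq> 0" "ev y \<noteq> 0"
    using f by auto
  have "degree (ev y) = 5"
    using \<open>degree f = 5\<close> \<open>degree (ev x) = 0\<close> nz by (simp add: f degree_mult_eq)
  moreover have "degree (ev y) \<le> degree y"
    unfolding ev_def by (rule map_poly_degree_leq)
  moreover have "A_red_7_4 \<noteq> 0"
    using degree_A_red_7_4 by auto
  then have "5 = degree x + (degree x + degree y)"
    using degree_A_red_7_4 by (auto simp: y degree_mult_eq)
  ultimately have "degree x = 0"
    by simp
  then obtain c where x: "x = [:c:]"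
    using degree_0_id by metis
  have "coeff A_red_7_4 0 = 1"
    by (simp add: A_red_7_4_def F_7_4_eq G_7_4_eq coeff_mult)
  then have "1 = c * (c * coeff y 0)"
    by (simp add: y x)
  then have "c dvd 1"
    by (rule dvdI)
  then show "x dvd 1"
    by (simp add: x is_unit_const_poly_iff)
qed

lemma A_red_7_4_dvd_A_7_4: "A_red_7_4 dvd A_7_4" and A_7_4_dvd: "A_7_4 dvd A_red_7_4 ^ 2"
  by (simp_all add: A_red_7_4_def A_7_4_def power2_eq_square)

end

theory Submission
  imports Defs
begin

text \<open>
  The fractions defined at \<open>q = 1\<close> form a subring on which specialization is a ring
  homomorphism, so each \<open>a_j\<close> can be specialized factor by factor. At \<open>q = 1\<close> the
  coefficients \<open>a_5, a_4, a_3\<close> become \<open>D * b_j\<close> with the common factor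
  \<open>D = (M - 1)^5 (M + 1)^4 (2 M^4 - 5 M^3 + 8 M^2 - 5 M + 2)\<close>. Since \<open>D\<close> is
  antipalindromic of degree \<open>13\<close>, the symmetry \<open>a_j = - M^24 a_(5-j)(1/M)\<close> turns into
  \<open>b_j = M^11 b_(5-j)(1/M)\<close>, which is the symmetry of the reduced \<open>A\<close>-polynomial.
\<close>

text \<open>A relation rather than the function \<open>at_q1\<close>: it records a denominator
  surviving at \<open>q = 1\<close> together with the value, so no separate definedness conditions
  are needed.\<close>

definition specializes :: "rat_fun_qM \<Rightarrow> int poly fract \<Rightarrow> bool" where
  "specializes x y \<longleftrightarrow>
    (\<exists>a b. x = Fract a b \<and> num_at_q1 b \<noteq> 0 \<and> y = Fract (num_at_q1 a) (num_at_q1 b))"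

lemma at_q1_eqI: "specializes x y \<Longrightarrow> at_q1 x = y"
  unfolding specializes_def using at_q1_Fract by blast

lemma num_at_q1_0 [simp]: "num_at_q1 0 = 0"
  by (simp add: num_at_q1_def)

lemma num_at_q1_1 [simp]: "num_at_q1 1 = 1"
  by (simp add: num_at_q1_def)

lemma num_at_q1_add: "num_at_q1 (a + b) = num_at_q1 a + num_at_q1 b"
  by (rule poly_eqI) (simp add: num_at_q1_def coeff_map_poly)

lemma num_at_q1_uminus: "num_at_q1 (- a) = - num_at_q1 a"
  by (rule poly_eqI) (simp add: num_at_q1_def coeff_map_poly)

lemma specializes_to_fract: "specializes (to_fract a) (to_fract (num_at_q1 a))"
  unfolding specializes_def to_fract_def by (intro exI[of _ a] exI[of _ 1]) simp

lemma specializes_0: "specializes 0 0"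
  using specializes_to_fract[of 0] by simp

lemma specializes_1: "specializes 1 1"
  using specializes_to_fract[of 1] by simp

lemma specializes_add:
  assumes "specializes x x'" "specializes y y'"
  shows "specializes (x + y) (x' + y')"
proof -
  obtain a b c d where x: "x = Fract a b" "num_at_q1 b \<noteq> 0" "x' = Fract (num_at_q1 a) (num_at_q1 b)"
    and y: "y = Fract c d" "num_at_q1 d \<noteq> 0" "y' = Fract (num_at_q1 c) (num_at_q1 d)"
    using assms unfolding specializes_def by blast
  moreover have "b \<noteq> 0" "d \<noteq> 0"
    using x y by auto
  ultimately show ?thesis
    unfolding specializes_def
    by (intro exI[of _ "a * d + c * b"] exI[of _ "b * d"])
      (simp add: num_at_q1_add num_at_q1_mult)
qed

lemma specializes_mult:
  assumes "specializes x x'" "specializes y y'"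
  shows "specializes (x * y) (x' * y')"
proof -
  obtain a b c d where "x = Fract a b" "num_at_q1 b \<noteq> 0" "x' = Fract (num_at_q1 a) (num_at_q1 b)"
    and "y = Fract c d" "num_at_q1 d \<noteq> 0" "y' = Fract (num_at_q1 c) (num_at_q1 d)"
    using assms unfolding specializes_def by blast
  then show ?thesis
    unfolding specializes_def
    by (intro exI[of _ "a * c"] exI[of _ "b * d"]) (simp add: num_at_q1_mult)
qed

lemma specializes_uminus: "specializes x x' \<Longrightarrow> specializes (- x) (- x')"
  unfolding specializes_def by (metis minus_fract num_at_q1_uminus)

lemma specializes_diff:
  "specializes x x' \<Longrightarrow> specializes y y' \<Longrightarrow> specializes (x - y) (x' - y')"
  using specializes_add[OF _ specializes_uminus, of x x' y y'] by simp

lemma specializes_power: "specializes x x' \<Longrightarrow> specializes (x ^ n) (x' ^ n)"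
  by (induction n) (auto intro: specializes_1 specializes_mult)

lemma specializes_numeral: "specializes (numeral k) (numeral k)"
proof -
  have "specializes (of_nat n) (of_nat n)" for n
    by (induction n) (auto intro: specializes_0 specializes_1 specializes_add)
  from this[of "numeral k"] show ?thesis
    by simp
qed

text \<open>Numerator and denominator trade places; \<open>x' \<noteq> 0\<close> keeps the new
  denominator nonzero at \<open>q = 1\<close>.\<close>

lemma specializes_inverse:
  assumes "specializes x x'" "x' \<noteq> 0"
  shows "specializes (inverse x) (inverse x')"
proof -
  obtain a b where "x = Fract a b" "num_at_q1 b \<noteq> 0" "x' = Fract (num_at_q1 a) (num_at_q1 b)"
    using assms(1) unfolding specializes_def by blast
  moreover from this have "num_at_q1 a \<noteq> 0"
    using assms(2) by (auto simp: fract_collapse)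
  ultimately show ?thesis
    unfolding specializes_def by (intro exI[of _ b] exI[of _ a]) simp
qed

lemma specializes_q: "specializes q_var 1"
  using specializes_to_fract[of "[:[:0, 1:]:]"]
  by (simp add: q_var_def num_at_q1_def map_poly_pCons one_pCons[symmetric])

lemma specializes_M: "specializes M_var (to_fract [:0, 1:])"
  using specializes_to_fract[of "[:0, 1:]"]
  by (simp add: M_var_def num_at_q1_def map_poly_pCons)

lemmas specializes_intros =
  specializes_add specializes_diff specializes_mult specializes_uminus specializes_power
  specializes_1 specializes_numeral specializes_q

text \<open>Polymorphic, as are \<open>b4\<close> to \<open>b1\<close>, to allow evaluation both in
  \<open>int poly\<close> and in its fraction field, where \<open>inverse m\<close> exists.\<close>

definition common_factor :: "'a::comm_ring_1 \<Rightarrow> 'a" where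
  "common_factor m = (m - 1) ^ 5 * (m + 1) ^ 4 * (2 * m ^ 4 - 5 * m ^ 3 + 8 * m ^ 2 - 5 * m + 2)"

text \<open>\<open>b4\<close>, \<open>b3\<close>, \<open>b2\<close>, \<open>b1\<close> are the
  coefficients of \<open>L^4\<close> to \<open>L^1\<close> in
  \<open>at_sqrt_M A_red_minus_7_4\<close>; those of \<open>L^5\<close> and \<open>L^0\<close> are
  \<open>1\<close> and \<open>m ^ 11\<close>.\<close>

definition b4 :: "'a::comm_ring_1 \<Rightarrow> 'a" where
  "b4 m = m ^ 7 - 2 * m ^ 6 + 3 * m ^ 5 + m ^ 4 - 6 * m ^ 3 + 4 * m ^ 2 + 7 * m - 3"

definition b3 :: "'a::comm_ring_1 \<Rightarrow> 'a" where
  "b3 m = - (m ^ 11) + 3 * m ^ 10 - 3 * m ^ 9 - 2 * m ^ 8 + 10 * m ^ 7 + 6 * m ^ 6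
     - 17 * m ^ 5 - 3 * m ^ 4 + 21 * m ^ 3 + 3 * m ^ 2 - 10 * m + 3"

definition b2 :: "'a::comm_ring_1 \<Rightarrow> 'a" where
  "b2 m = 3 * m ^ 11 - 10 * m ^ 10 + 3 * m ^ 9 + 21 * m ^ 8 - 3 * m ^ 7 - 17 * m ^ 6
     + 6 * m ^ 5 + 10 * m ^ 4 - 2 * m ^ 3 - 3 * m ^ 2 + 3 * m - 1"

definition b1 :: "'a::comm_ring_1 \<Rightarrow> 'a" where
  "b1 m = - 3 * m ^ 11 + 7 * m ^ 10 + 4 * m ^ 9 - 6 * m ^ 8 + m ^ 7 + 3 * m ^ 6
     - 2 * m ^ 5 + m ^ 4"

text \<open>Leaves the value \<open>y\<close> schematic: the closure rules compute it from the shape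
  of \<open>x\<close>, and a polynomial identity \<open>y = z\<close> remains.\<close>

lemma specializes_eq_rhs: "specializes x y \<Longrightarrow> y = z \<Longrightarrow> specializes x z"
  by simp

lemma specializes_a5:
  assumes "specializes x y"
  shows "specializes (a5 x) (common_factor y)"
  unfolding a5_def Let_def
  by (rule specializes_eq_rhs, (rule specializes_intros assms)+, simp add: common_factor_def, algebra)

text \<open>The outer factors again give \<open>(y - 1)^5 (y + 1)^4\<close>; the factor of degree 11
  becomes the quartic of \<open>common_factor\<close> times \<open>b4 y\<close>.\<close>

lemma specializes_a4:
  assumes "specializes x y"
  shows "specializes (a4 x) (common_factor y * b4 y)"
  unfolding a4_def Let_def
  by (rule specializes_eq_rhs, (rule specializes_intros assms)+, simp add: common_factor_def b4_def, algebra)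

text \<open>As for \<open>a4\<close>, with a factor of degree 15; the leading minus sign of
  \<open>a3\<close> is absorbed into \<open>b3\<close>.\<close>

lemma specializes_a3:
  assumes "specializes x y"
  shows "specializes (a3 x) (common_factor y * b3 y)"
  unfolding a3_def Let_def
  by (rule specializes_eq_rhs, (rule specializes_intros assms)+, simp add: common_factor_def b3_def, algebra)

text \<open>The quartic and \<open>m + 1\<close> are palindromic, while each of the five factors
  \<open>m - 1\<close> contributes a sign.\<close>

lemma common_factor_inverse:
  fixes m :: "'a::field"
  assumes "m \<noteq> 0"
  shows "m ^ 13 * common_factor (inverse m) = - common_factor m"
  using assms unfolding common_factor_def
  by (simp add: field_simps eval_nat_numeral)

text \<open>Reversal is with respect to degree 11, not the degree 7 of \<open>b4\<close>; hence
  \<open>b1\<close> is divisible by \<open>m ^ 4\<close>.\<close>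

lemma b4_inverse:
  fixes m :: "'a::field"
  assumes "m \<noteq> 0"
  shows "m ^ 11 * b4 (inverse m) = b1 m"
  using assms unfolding b4_def b1_def
  by (simp add: field_simps eval_nat_numeral)

lemma b3_inverse:
  fixes m :: "'a::field"
  assumes "m \<noteq> 0"
  shows "m ^ 11 * b3 (inverse m) = b2 m"
  using assms unfolding b3_def b2_def
  by (simp add: field_simps eval_nat_numeral)


lemma specializes_coeff:
  fixes m defines "m \<equiv> to_fract [:0, 1:] :: int poly fract"
  shows "j \<le> 5 \<Longrightarrow> specializes (a_coeff j) (common_factor m * [m ^ 11, b1 m, b2 m, b3 m, b4 m, 1] ! j)"
proof -
  have m: "specializes M_var m" and "m \<noteq> 0"
    using specializes_M by (simp_all add: m_def)
  have inv: "specializes (inverse (q_var ^ 5 * M_var)) (inverse m)"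
    using specializes_inverse[OF specializes_mult[OF specializes_power[OF specializes_q] m]]
      \<open>m \<noteq> 0\<close> by simp
  have low: "specializes (- (q_var ^ 60) * M_var ^ 24 * x) (common_factor m * z)"
    if "specializes x (common_factor (inverse m) * y)" "m ^ 11 * y = z" for x y z
  proof (rule specializes_eq_rhs)
    show "specializes (- (q_var ^ 60) * M_var ^ 24 * x)
      (- (1 ^ 60) * m ^ 24 * (common_factor (inverse m) * y))"
      by (rule specializes_intros m that)+
    \<comment> \<open>The power 13 reverses \<open>common_factor\<close>, whose sign cancels the
      leading minus; the power 11 reverses the cofactor \<open>y\<close>.\<close>
    have "m ^ 24 = m ^ 13 * m ^ 11"
      by (simp flip: power_add)
    then have "- (1 ^ 60) * m ^ 24 * (common_factor (inverse m) * y)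
        = - (m ^ 13 * common_factor (inverse m)) * (m ^ 11 * y)"
      by simp
    then show "- (1 ^ 60) * m ^ 24 * (common_factor (inverse m) * y) = common_factor m * z"
      using common_factor_inverse[OF \<open>m \<noteq> 0\<close>] that(2) by simp
  qed
  \<comment> \<open>The cofactor of \<open>a5\<close> is \<open>1\<close>, so its reversal is
    \<open>m ^ 11\<close>.\<close>
  have "specializes (a_coeff 0) (common_factor m * m ^ 11)"
    using low[of "a5 (inverse (q_var ^ 5 * M_var))" 1] specializes_a5[OF inv]
    by (simp add: a_coeff_def a_top_def)
  moreover have "specializes (a_coeff 1) (common_factor m * b1 m)"
    using low[OF specializes_a4[OF inv] b4_inverse[OF \<open>m \<noteq> 0\<close>]]
    by (simp add: a_coeff_def a_top_def)
  moreover have "specializes (a_coeff 2) (common_factor m * b2 m)"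
    using low[OF specializes_a3[OF inv] b3_inverse[OF \<open>m \<noteq> 0\<close>]]
    by (simp add: a_coeff_def a_top_def)
  moreover have "specializes (a_coeff 3) (common_factor m * b3 m)" "specializes (a_coeff 4) (common_factor m * b4 m)"
    "specializes (a_coeff 5) (common_factor m)"
    using specializes_a3[OF m] specializes_a4[OF m] specializes_a5[OF m]
    by (simp_all add: a_coeff_def a_top_def)
  moreover assume "j \<le> 5"
  then have "j = 0 \<or> j = 1 \<or> j = 2 \<or> j = 3 \<or> j = 4 \<or> j = 5"
    by linarith
  ultimately show "specializes (a_coeff j) (common_factor m * [m ^ 11, b1 m, b2 m, b3 m, b4 m, 1] ! j)"
    by auto
qed

lemma at_sqrt_A_red_minus_7_4:
  fixes M defines "M \<equiv> [:0, 1:] :: int poly"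
  shows "at_sqrt_M A_red_minus_7_4 = [:M ^ 11, b1 M, b2 M, b3 M, b4 M, 1:]"
  unfolding subst_M_squared_A_red_minus_7_4 at_sqrt_M_subst M_def b1_def b2_def b3_def b4_def
  by (simp add: eval_nat_numeral numeral_poly one_pCons)

lemma to_fract_numeral [simp]: "to_fract (numeral k) = numeral k"
proof -
  have "to_fract (of_nat n) = of_nat n" for n
    by (induction n) simp_all
  from this[of "numeral k"] show ?thesis
    by simp
qed

lemma to_fract_power [simp]: "to_fract (x ^ n) = to_fract x ^ n"
  by (induction n) simp_all

theorem corollary1p3:
  shows "map_poly at_q1 P_7_4 =
    (let M = [:0, 1:] :: int poly in
      map_poly to_fract
        (at_sqrt_M A_red_minus_7_4 *
          [:(M - 1) ^ 5 * (M + 1) ^ 4 * (2 * M ^ 4 - 5 * M ^ 3 + 8 * M ^ 2 - 5 * M + 2):]))"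
proof -
  define M where "M = ([:0, 1:] :: int poly)"
  define m where "m = to_fract M"
  have P: "coeff P_7_4 j = (if j \<le> 5 then a_coeff j else 0)" for j
    by (simp add: P_7_4_def coeff_sum if_distrib cong: if_cong)
  have hom: "to_fract (b1 M) = b1 m" "to_fract (b2 M) = b2 m" "to_fract (b3 M) = b3 m"
    "to_fract (b4 M) = b4 m" "to_fract (common_factor M) = common_factor m"
    by (simp_all add: m_def b1_def b2_def b3_def b4_def common_factor_def)
  have "map_poly at_q1 P_7_4 = map_poly to_fract (at_sqrt_M A_red_minus_7_4 * [:common_factor M:])"
  proof (rule poly_eqI)
    fix j
    have A: "coeff (at_sqrt_M A_red_minus_7_4) j =
        (if j \<le> 5 then [M ^ 11, b1 M, b2 M, b3 M, b4 M, 1] ! j else 0)"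
      by (simp add: at_sqrt_A_red_minus_7_4 coeff_pCons M_def nth_Cons split: nat.split)
    have "to_fract ([M ^ 11, b1 M, b2 M, b3 M, b4 M, 1] ! j) =
        [m ^ 11, b1 m, b2 m, b3 m, b4 m, 1] ! j" if "j \<le> 5"
      using that by (simp add: nth_Cons hom m_def[symmetric] split: nat.split)
    then show "coeff (map_poly at_q1 P_7_4) j =
        coeff (map_poly to_fract (at_sqrt_M A_red_minus_7_4 * [:common_factor M:])) j"
      \<comment> \<open>\<open>at_q1_0\<close> makes \<open>map_poly at_q1\<close> act
        coefficientwise and settles \<open>j > 5\<close>, where both sides vanish.\<close>
      using at_q1_eqI[OF specializes_coeff[of j]]
      by (simp add: coeff_map_poly at_q1_0 P A hom m_def[symmetric] M_def[symmetric] mult.commute)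
  qed
  then show ?thesis
    by (simp only: Let_def M_def common_factor_def)
qed

end
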